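(* Let $f_1,\dots,f_m:\mathcal{M}\to\mathbb{R}$ be locally Lipschitz functions on the complete Riemannian manifold $\mathcal{M}$, and let $x\in\mathcal{M}$ be a local weak Pareto optimizer of the problem $\min_{x\in\mathcal{M}}F(x)=(f_1(x),\dots,f_m(x))^T$. Then $$0_x\in \operatorname{conv}G(x),\qquad\text{where } G(x)=\bigcup_{i=1}^m\partial f_i(x).$$
   Context: $\mathcal{M}$ is a complete $d$-dimensional ($d\ge 1$) smooth Riemannian manifold with metric $\langle\cdot,\cdot\rangle$ on tangent spaces $T_x\mathcal{M}$, induced norm $\|\cdot\|$, and Riemannian distance $\mathrm{dist}$. $0_x$ is the zero of $T_x\mathcal{M}$, $\operatorname{conv}$ is the convex hull, and $\mathbb{B}(x,\sigma)=\{y\in\mathcal{M}:\mathrm{dist}(x,y)<\sigma\}$. Retraction: a smooth map $R:T\mathcal{M}\to\mathcal{M}$ is fixed such that, with $R_x=R|_{T_x\mathcal{M}}$, one has $R_x(0_x)=x$ and $\mathrm{D}R_x(0_x)=\mathrm{id}_{T_x\mathcal{M}}$ for all $x$. It is assumed that there is a constant $\kappa>0$ with $\mathrm{dist}(R_x(\xi_x),x)\le\kappa\|\xi_x\|$ for all $x\in\mathcal{M}$, $\xi_x\in T_x\mathcal{M}$. Locally Lipschitz: $f:\mathcal{M}\to\mathbb{R}$ is locally Lipschitz if every $x\in\mathcal{M}$ has a neighborhood $\mathcal{N}$ and a constant $L>0$ with $|f(z)-f(y)|\le L\,\mathrm{dist}(z,y)$ for all $z,y\in\mathcal{N}$. Subdifferential: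 for a locally Lipschitz $\phi:X\to\mathbb{R}$ on a Hilbert space $X$, $\phi^\circ(x;v)=\limsup_{y\to x,\,t\downarrow0}\frac{\phi(y+tv)-\phi(y)}{t}$ and $\partial\phi(x)=\{\xi\in X:\langle\xi,v\rangle\le\phi^\circ(x;v)\ \forall v\in X\}$ (Clarke subdifferential). For locally Lipschitz $f:\mathcal{M}\to\mathbb{R}$, put $\hat f_x=f\circ R_x:T_x\mathcal{M}\to\mathbb{R}$; the Riemannian subdifferential is $\partial f(x)=\partial\hat f_x(0_x)\subset T_x\mathcal{M}$. Pareto notions: $x$ is a weak Pareto optimizer if there is no $y\in\mathcal{M}$ with $f_i(y)<f_i(x)$ for all $i=1,\dots,m$. $x$ is a local weak Pareto optimizer if for some $\sigma>0$ there is no $y\in\mathbb{B}(x,\sigma)$ with $f_i(y)<f_i(x)$ for all $i=1,\dots,m$. *)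

theory Defs
  imports "HOL-Analysis.Analysis"
begin

section \<open>Smooth maps between Euclidean spaces\<close>

text \<open>\<open>Ck_on k S f\<close> is only meant for open \<open>S\<close>. For such \<open>S\<close> the derivative at every point of
  \<open>S\<close> is unique, and \<open>f\<close> is of class \<open>C^(k+1)\<close> iff it is differentiable and all its directional
  derivatives are of class \<open>C^k\<close>.\<close>

primrec Ck_on ::
  "nat \<Rightarrow> 'a::real_normed_vector set \<Rightarrow> ('a \<Rightarrow> 'b::real_normed_vector) \<Rightarrow> bool" where
  "Ck_on 0 S f \<longleftrightarrow> continuous_on S f"
| "Ck_on (Suc k) S f \<longleftrightarrow>
     (\<forall>x\<in>S. f differentiable (at x)) \<and>
     (\<forall>v. Ck_on k S (\<lambda>x. frechet_derivative f (at x) v))"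

definition smooth_on ::
  "'a::real_normed_vector set \<Rightarrow> ('a \<Rightarrow> 'b::real_normed_vector) \<Rightarrow> bool" where
  "smooth_on S f \<longleftrightarrow> (\<forall>k. Ck_on k S f)"

section \<open>Smooth manifolds and tangent vectors\<close>

text \<open>The points of the manifold are the elements of a type \<open>'m\<close>. A chart is a pair of its domain
  and its coordinate map; only the values of the map on the domain matter.\<close>

type_synonym ('m, 'e) chart = "'m set \<times> ('m \<Rightarrow> 'e)"

abbreviation chart_inv :: "('m, 'e) chart \<Rightarrow> 'e \<Rightarrow> 'm" where
  "chart_inv c \<equiv> inv_into (fst c) (snd c)"

abbreviation chart_range :: "('m, 'e) chart \<Rightarrow> 'e set" where
  "chart_range c \<equiv> snd c ` fst c"

definition is_chart :: "('m::topological_space, 'e::euclidean_space) chart \<Rightarrow> bool" where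
  "is_chart c \<longleftrightarrow>
     open (fst c) \<and> open (chart_range c) \<and>
     homeomorphism (fst c) (chart_range c) (snd c) (chart_inv c)"

definition smooth_atlas :: "('m::topological_space, 'e::euclidean_space) chart set \<Rightarrow> bool" where
  "smooth_atlas A \<longleftrightarrow>
     (\<forall>c\<in>A. is_chart c) \<and> (\<Union>c\<in>A. fst c) = UNIV \<and>
     (\<forall>c\<in>A. \<forall>d\<in>A. smooth_on (snd c ` (fst c \<inter> fst d)) (snd d \<circ> chart_inv c))"

text \<open>Tangent vectors at \<open>p\<close> are classes of pairs (chart around \<open>p\<close>, coordinate vector), two pairs
  being identified when the derivative of the transition map carries one vector to the other. Each
  class has a unique representative in any given chart around \<open>p\<close>. We fix for every \<open>p\<close> an
  arbitrary chart \<open>chart_at M p\<close> of the atlas around \<open>p\<close>, and write a tangent vector at \<open>p\<close> as its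
  coordinate vector in that chart: the tangent space at \<open>p\<close> is the vector space \<open>'e\<close>, its zero is
  \<open>0\<close>, and the tangent bundle is \<open>'m \<times> 'e\<close> as a set (its smooth structure is not the product one;
  see \<open>tangent_param\<close>). The inner product of the tangent space at \<open>p\<close> is \<open>metric M p\<close> and has
  nothing to do with the inner product of the type \<open>'e\<close>.\<close>

record ('m, 'e) riemannian =
  atlas :: "('m, 'e) chart set"
  chart_at :: "'m \<Rightarrow> ('m, 'e) chart"
  metric :: "'m \<Rightarrow> 'e \<Rightarrow> 'e \<Rightarrow> real"

text \<open>The inverse of the bundle chart of the tangent bundle induced by \<open>c\<close>: \<open>tangent_vec M c z w\<close>
  is the tangent vector at \<open>chart_inv c z\<close> with coordinates \<open>w\<close> in the chart \<open>c\<close>.\<close>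

definition tangent_vec ::
  "('m, 'e::euclidean_space) riemannian \<Rightarrow> ('m, 'e) chart \<Rightarrow> 'e \<Rightarrow> 'e \<Rightarrow> 'e" where
  "tangent_vec M c z w =
     frechet_derivative (snd (chart_at M (chart_inv c z)) \<circ> chart_inv c) (at z) w"

definition tangent_param ::
  "('m, 'e::euclidean_space) riemannian \<Rightarrow> ('m, 'e) chart \<Rightarrow> 'e \<times> 'e \<Rightarrow> 'm \<times> 'e" where
  "tangent_param M c = (\<lambda>(z, w). (chart_inv c z, tangent_vec M c z w))"

section \<open>Riemannian metrics and the Riemannian distance\<close>

definition inner_product :: "('a::real_vector \<Rightarrow> 'a \<Rightarrow> real) \<Rightarrow> bool" where
  "inner_product B \<longleftrightarrow>
     bilinear B \<and> (\<forall>u v. B u v = B v u) \<and> (\<forall>v. v \<noteq> 0 \<longrightarrow> B v v > 0)"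

text \<open>The last conjunct says that the coefficients of the metric in every chart are smooth.\<close>

definition riemannian_manifold ::
  "('m::{t2_space, second_countable_topology}, 'e::euclidean_space) riemannian \<Rightarrow> bool" where
  "riemannian_manifold M \<longleftrightarrow>
     smooth_atlas (atlas M) \<and>
     (\<forall>p. chart_at M p \<in> atlas M \<and> p \<in> fst (chart_at M p)) \<and>
     (\<forall>p. inner_product (metric M p)) \<and>
     (\<forall>c\<in>atlas M. \<forall>u v. smooth_on (chart_range c)
        (\<lambda>z. metric M (chart_inv c z) (tangent_vec M c z u) (tangent_vec M c z v)))"

definition tangent_norm :: "('m, 'e) riemannian \<Rightarrow> 'm \<Rightarrow> 'e \<Rightarrow> real" where
  "tangent_norm M p v = sqrt (metric M p v v)"

definition C1_curve_on ::
  "('m::topological_space, 'e::euclidean_space) riemannian \<Rightarrow> real set \<Rightarrow> (real \<Rightarrow> 'm) \<Rightarrow> bool" where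
  "C1_curve_on M I \<gamma> \<longleftrightarrow>
     continuous_on I \<gamma> \<and>
     (\<forall>c\<in>atlas M.
        (\<forall>t\<in>I. \<gamma> t \<in> fst c \<longrightarrow> (snd c \<circ> \<gamma>) differentiable (at t within I)) \<and>
        continuous_on {t\<in>I. \<gamma> t \<in> fst c} (\<lambda>t. vector_derivative (snd c \<circ> \<gamma>) (at t within I)))"

definition piecewise_C1_curve ::
  "('m::topological_space, 'e::euclidean_space) riemannian \<Rightarrow> (real \<Rightarrow> 'm) \<Rightarrow> bool" where
  "piecewise_C1_curve M \<gamma> \<longleftrightarrow>
     continuous_on {0..1} \<gamma> \<and>
     (\<exists>S. finite S \<and>
        (\<forall>a b. 0 \<le> a \<and> a < b \<and> b \<le> 1 \<and> {a<..<b} \<inter> S = {} \<longrightarrow> C1_curve_on M {a..b} \<gamma>))"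

definition velocity ::
  "('m, 'e::euclidean_space) riemannian \<Rightarrow> (real \<Rightarrow> 'm) \<Rightarrow> real \<Rightarrow> 'e" where
  "velocity M \<gamma> t = vector_derivative (snd (chart_at M (\<gamma> t)) \<circ> \<gamma>) (at t within {0..1})"

text \<open>The velocity is unspecified at the finitely many break points; these do not affect the
  integral.\<close>

definition curve_length ::
  "('m, 'e::euclidean_space) riemannian \<Rightarrow> (real \<Rightarrow> 'm) \<Rightarrow> real" where
  "curve_length M \<gamma> = integral {0..1} (\<lambda>t. tangent_norm M (\<gamma> t) (velocity M \<gamma> t))"

text \<open>Connectedness is not assumed; the distance between points in different components is
  \<open>\<infinity>\<close>.\<close>

definition rdist ::
  "('m::topological_space, 'e::euclidean_space) riemannian \<Rightarrow> 'm \<Rightarrow> 'm \<Rightarrow> ereal" where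
  "rdist M p q =
     (INF \<gamma>\<in>{\<gamma>. piecewise_C1_curve M \<gamma> \<and> \<gamma> 0 = p \<and> \<gamma> 1 = q}. ereal (curve_length M \<gamma>))"

definition riemannian_ball ::
  "('m::topological_space, 'e::euclidean_space) riemannian \<Rightarrow> 'm \<Rightarrow> real \<Rightarrow> 'm set" where
  "riemannian_ball M x \<sigma> = {y. rdist M x y < ereal \<sigma>}"

definition riemannian_complete ::
  "('m::topological_space, 'e::euclidean_space) riemannian \<Rightarrow> bool" where
  "riemannian_complete M \<longleftrightarrow>
     (\<forall>X :: nat \<Rightarrow> 'm.
        (\<forall>\<epsilon>>0. \<exists>N. \<forall>j\<ge>N. \<forall>k\<ge>N. rdist M (X j) (X k) < ereal \<epsilon>) \<longrightarrow>
        (\<exists>l. \<forall>\<epsilon>>0. \<exists>N. \<forall>k\<ge>N. rdist M (X k) l < ereal \<epsilon>))"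

section \<open>Retractions\<close>

text \<open>\<open>R x \<xi>\<close> is the value of the retraction at the tangent vector \<open>\<xi>\<close> at \<open>x\<close>. The first two
  conjuncts express smoothness on the tangent bundle in bundle charts (by continuity the set in the
  second one is open). Since \<open>R x 0 = x\<close>, both tangent spaces involved in the derivative of \<open>R x\<close>
  at \<open>0\<close> are written in the coordinates of \<open>chart_at M x\<close>.\<close>

definition riemannian_retraction ::
  "('m::topological_space, 'e::euclidean_space) riemannian \<Rightarrow> ('m \<Rightarrow> 'e \<Rightarrow> 'm) \<Rightarrow> bool" where
  "riemannian_retraction M R \<longleftrightarrow>
     (\<forall>c\<in>atlas M. continuous_on (chart_range c \<times> UNIV) (case_prod R \<circ> tangent_param M c)) \<and>
     (\<forall>c\<in>atlas M. \<forall>d\<in>atlas M.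
        smooth_on {zw \<in> chart_range c \<times> UNIV. case_prod R (tangent_param M c zw) \<in> fst d}
          (snd d \<circ> case_prod R \<circ> tangent_param M c)) \<and>
     (\<forall>x. R x 0 = x) \<and>
     (\<forall>x. (snd (chart_at M x) \<circ> R x has_derivative (\<lambda>\<xi>. \<xi>)) (at 0))"

section \<open>Locally Lipschitz functions and subdifferentials\<close>

definition riemannian_locally_Lipschitz ::
  "('m::topological_space, 'e::euclidean_space) riemannian \<Rightarrow> ('m \<Rightarrow> real) \<Rightarrow> bool" where
  "riemannian_locally_Lipschitz M f \<longleftrightarrow>
     (\<forall>x. \<exists>N L. open N \<and> x \<in> N \<and> L > 0 \<and>
        (\<forall>z\<in>N. \<forall>y\<in>N. ereal \<bar>f z - f y\<bar> \<le> ereal L * rdist M z y))"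

text \<open>The limit superior is taken in the topology of the type. On a finite-dimensional space it is
  the topology of every inner product, so the Hilbert space structure used for the subdifferential
  can be passed as the separate argument \<open>B\<close>.\<close>

definition clarke_derivative ::
  "('a::real_normed_vector \<Rightarrow> real) \<Rightarrow> 'a \<Rightarrow> 'a \<Rightarrow> ereal" where
  "clarke_derivative \<phi> x v =
     Limsup (nhds x \<times>\<^sub>F at_right 0) (\<lambda>(y, t). ereal ((\<phi> (y + t *\<^sub>R v) - \<phi> y) / t))"

definition clarke_subdifferential ::
  "('a::euclidean_space \<Rightarrow> 'a \<Rightarrow> real) \<Rightarrow> ('a \<Rightarrow> real) \<Rightarrow> 'a \<Rightarrow> 'a set" where
  "clarke_subdifferential B \<phi> x = {\<xi>. \<forall>v. ereal (B \<xi> v) \<le> clarke_derivative \<phi> x v}"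

definition riemannian_subdifferential ::
  "('m, 'e::euclidean_space) riemannian \<Rightarrow> ('m \<Rightarrow> 'e \<Rightarrow> 'm) \<Rightarrow> ('m \<Rightarrow> real) \<Rightarrow> 'm \<Rightarrow> 'e set" where
  "riemannian_subdifferential M R f x = clarke_subdifferential (metric M x) (f \<circ> R x) 0"

section \<open>Local weak Pareto optimality\<close>

definition local_weak_Pareto ::
  "('m::topological_space, 'e::euclidean_space) riemannian \<Rightarrow> nat \<Rightarrow> (nat \<Rightarrow> 'm \<Rightarrow> real) \<Rightarrow> 'm \<Rightarrow> bool"
where
  "local_weak_Pareto M m f x \<longleftrightarrow>
     (\<exists>\<sigma>>0. \<not> (\<exists>y\<in>riemannian_ball M x \<sigma>. \<forall>i\<in>{1..m}. f i y < f i x))"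

end

theory Submission
  imports Defs
begin

text \<open>
  Pulling everything back along the retraction turns the claim into a statement about locally
  Lipschitz functions on one Euclidean space. With \<open>\<phi>\<^sub>i = f\<^sub>i \<circ> R\<^sub>x\<close> on the
  tangent space at \<open>x\<close>, the subdifferential of \<open>f\<^sub>i\<close> at \<open>x\<close> is by definition the Clarke
  subdifferential of \<open>\<phi>\<^sub>i\<close> at \<open>0\<close>.

  The Euclidean statement is a duality argument. The Clarke derivative \<open>q\<^sub>i\<close> of a Lipschitz
  function at a point is a finite sublinear function of the direction, and the Clarke
  subdifferential is the compact convex set of linear functionals below \<open>q\<^sub>i\<close>; by Hahn-Banach,
  \<open>q\<^sub>i\<close> is the support function of that set. If \<open>0\<close> were outside the (compact) convex hull of
  the union of these sets, a separating hyperplane would give a direction \<open>v\<close> in which all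
  \<open>q\<^sub>i\<close> are negative. Then all \<open>\<phi>\<^sub>i\<close> decrease strictly along \<open>v\<close> from the base point,
  which contradicts weak Pareto optimality. This is
  \<open>zero_in_hull_of_clarke_subdifferentials\<close>.

  The geometric input is that \<open>R\<^sub>x\<close> is Lipschitz near \<open>0\<close> from the coordinate norm to the
  Riemannian distance, lemma \<open>retraction_locally_Lipschitz\<close>: the image under \<open>R\<^sub>x\<close> of a
  segment is an admissible curve, and on a compact ball its speed is bounded by a multiple of the
  length of the segment, since the first derivatives of \<open>R\<^sub>x\<close> and the coefficients of the
  metric in a chart are continuous. This makes the \<open>\<phi>\<^sub>i\<close> locally Lipschitz, and it puts
  \<open>R\<^sub>x \<xi>\<close> inside any given Riemannian ball about \<open>x\<close> for small \<open>\<xi>\<close>, so that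
  optimality of \<open>x\<close> is inherited by \<open>0\<close>.
\<close>

section \<open>Sublinear functions and their supporting functionals\<close>

definition sublinear :: "('a::real_vector \<Rightarrow> real) \<Rightarrow> bool" where
  "sublinear q \<longleftrightarrow>
     (\<forall>u v. q (u + v) \<le> q u + q v) \<and> (\<forall>c>0. \<forall>v. q (c *\<^sub>R v) = c * q v)"

lemma sublinear_zero: "sublinear q \<Longrightarrow> q 0 = 0"
proof -
  assume "sublinear q"
  then have "q (2 *\<^sub>R 0) = 2 * q 0" unfolding sublinear_def by (metis zero_less_numeral)
  then show ?thesis by simp
qed

lemma sublinear_line:
  assumes q: "sublinear q"
  shows "t * q v \<le> q (t *\<^sub>R v)"
proof -
  have pos: "0 \<le> q v + q (- v)"
    using q sublinear_zero[OF q] unfolding sublinear_def by (metis add.right_inverse)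
  consider "t = 0" | "t > 0" | "t < 0" by linarith
  then show ?thesis
  proof cases
    case 3
    then have "q (t *\<^sub>R v) = (- t) * q (- v)"
      using q unfolding sublinear_def by (metis neg_0_less_iff_less scaleR_minus_right scaleR_minus_left minus_minus)
    moreover have "0 \<le> (- t) * (q v + q (- v))"
      using 3 pos by (intro mult_nonneg_nonneg) auto
    ultimately show ?thesis by (simp add: algebra_simps)
  qed (use q sublinear_zero[OF q] in \<open>auto simp: sublinear_def\<close>)
qed

definition supporting_functionals :: "('a::real_inner \<Rightarrow> real) \<Rightarrow> 'a set" where
  "supporting_functionals q = {\<xi>. \<forall>u. \<xi> \<bullet> u \<le> q u}"

text \<open>The finite-dimensional Hahn-Banach theorem. The functional is read off from a hyperplane that
  separates the strict epigraph of \<open>q\<close> from the line through \<open>(v, q v)\<close>. The two sets are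
  disjoint because a sublinear function lies above each linear function that it agrees with at one
  vector, on the line spanned by that vector.\<close>

lemma sublinear_attained:
  fixes q :: "'e::euclidean_space \<Rightarrow> real"
  assumes q: "sublinear q"
  shows "\<exists>\<xi>\<in>supporting_functionals q. \<xi> \<bullet> v = q v"
proof -
  define S where "S = {(u, s). q u < s}"
  define T where "T = range (\<lambda>t. (t *\<^sub>R v, t * q v))"
  have "convex S"
  proof (rule convexI)
    fix x y :: "'e \<times> real" and a b :: real
    assume x: "x \<in> S" and y: "y \<in> S" and ab: "0 \<le> a" "0 \<le> b" "a + b = 1"
    obtain u s u' s' where xy: "x = (u, s)" "y = (u', s')" "q u < s" "q u' < s'"
      using x y by (auto simp: S_def)
    have "q (a *\<^sub>R u + b *\<^sub>R u') < a * s + b * s'"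
    proof (cases "a = 0 \<or> b = 0")
      case True
      then show ?thesis using ab xy by auto
    next
      case False
      then have pos: "a > 0" "b > 0" using ab by auto
      have "q (a *\<^sub>R u + b *\<^sub>R u') \<le> a * q u + b * q u'"
        using q pos unfolding sublinear_def by metis
      also have "\<dots> < a * s + b * s'"
        using pos xy by (intro add_strict_mono mult_strict_left_mono)
      finally show ?thesis .
    qed
    then show "a *\<^sub>R x + b *\<^sub>R y \<in> S" by (simp add: S_def xy)
  qed
  moreover have "convex T"
  proof -
    have "linear (\<lambda>t. (t *\<^sub>R v, t * q v))"
      by (rule linearI) (auto simp: algebra_simps)
    then show ?thesis unfolding T_def by (intro convex_linear_image) auto
  qed
  moreover have "S \<noteq> {}" "T \<noteq> {}"
    using gt_ex[of "q 0"] by (auto simp: S_def T_def)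
  moreover have "S \<inter> T = {}"
  proof -
    have "\<not> q (t *\<^sub>R v) < t * q v" for t using sublinear_line[OF q, of t v] by simp
    then show ?thesis by (auto simp: S_def T_def)
  qed
  ultimately obtain w b where w: "w \<noteq> 0" "\<forall>p\<in>S. w \<bullet> p \<le> b" "\<forall>p\<in>T. b \<le> w \<bullet> p"
    using separating_hyperplane_sets[of S T] by blast
  obtain a \<alpha> where wa: "w = (a, \<alpha>)" by fastforce
  have nz: "(a, \<alpha>) \<noteq> (0 :: 'e \<times> real)" using w(1) by (simp add: wa)
  have Sb: "a \<bullet> u + \<alpha> * s \<le> b" if "q u < s" for u s
    using w(2) that by (auto simp: S_def wa inner_Pair)
  have Tb: "b \<le> t * (a \<bullet> v + \<alpha> * q v)" for t
  proof -
    have "b \<le> w \<bullet> (t *\<^sub>R v, t * q v)" using w(3) unfolding T_def by blast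
    then show ?thesis by (simp add: wa inner_Pair algebra_simps)
  qed
  (* An affine function of t that is bounded below is constant. *)
  have line: "a \<bullet> v + \<alpha> * q v = 0"
  proof (rule ccontr)
    assume "a \<bullet> v + \<alpha> * q v \<noteq> 0"
    then show False
      using Tb[of "(b - 1) / (a \<bullet> v + \<alpha> * q v)"] by simp
  qed
  have b0: "b \<le> 0" using Tb[of 0] by simp
  have le: "a \<bullet> u + \<alpha> * q u \<le> 0" for u
  proof (rule field_le_epsilon)
    fix e :: real assume "e > 0"
    (* The epigraph is strict, so its bounding inequality is used slightly above q u; the sign of
       the last coefficient is not known yet, hence its absolute value. *)
    define \<delta> where "\<delta> = e / (\<bar>\<alpha>\<bar> + 1)"
    have "\<delta> > 0" using \<open>e > 0\<close> by (simp add: \<delta>_def)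
    then have "a \<bullet> u + \<alpha> * (q u + \<delta>) \<le> 0" using Sb[of u "q u + \<delta>"] b0 by simp
    moreover have "- (\<alpha> * \<delta>) \<le> (\<bar>\<alpha>\<bar> + 1) * \<delta>"
      using \<open>\<delta> > 0\<close> by (simp only: minus_mult_left) (intro mult_right_mono, auto)
    moreover have "(\<bar>\<alpha>\<bar> + 1) * \<delta> = e" by (simp add: \<delta>_def)
    ultimately show "a \<bullet> u + \<alpha> * q u \<le> 0 + e" by (simp add: algebra_simps)
  qed
  have "\<alpha> \<le> 0"
  proof -
    have "\<alpha> * 1 \<le> b" using Sb[of 0 1] sublinear_zero[OF q] by simp
    then show ?thesis using b0 by simp
  qed
  (* A vertical hyperplane is impossible since the epigraph projects onto the whole space. *)
  moreover have "\<alpha> \<noteq> 0"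
  proof
    assume "\<alpha> = 0"
    then have "a \<bullet> a \<le> 0" using le[of a] by simp
    then have "a = 0" by (metis inner_ge_zero inner_eq_zero_iff order_antisym)
    then show False using nz \<open>\<alpha> = 0\<close> by (simp add: zero_prod_def)
  qed
  ultimately have neg: "\<alpha> < 0" by simp
  define \<xi> where "\<xi> = (1 / - \<alpha>) *\<^sub>R a"
  have inner: "\<xi> \<bullet> u = (a \<bullet> u) / - \<alpha>" for u by (simp add: \<xi>_def)
  have "\<xi> \<bullet> u \<le> q u" for u
    using le[of u] neg by (simp add: inner field_simps)
  moreover have "\<xi> \<bullet> v = q v"
    using line neg by (simp add: inner field_simps)
  ultimately show ?thesis by (auto simp: supporting_functionals_def)
qed

text \<open>The values of \<open>q\<close> at plus and minus the basis vectors bound each coordinate.\<close>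

lemma compact_supporting_functionals:
  fixes q :: "'e::euclidean_space \<Rightarrow> real"
  shows "compact (supporting_functionals q)"
proof -
  have "closed (\<Inter>u. {\<xi>. \<xi> \<bullet> u \<le> q u})"
    by (intro closed_INT ballI closed_Collect_le continuous_intros)
  moreover have "supporting_functionals q = (\<Inter>u. {\<xi>. \<xi> \<bullet> u \<le> q u})"
    by (auto simp: supporting_functionals_def)
  moreover have "bounded (supporting_functionals q)"
  proof (rule boundedI)
    fix \<xi> assume "\<xi> \<in> supporting_functionals q"
    then have u: "\<xi> \<bullet> u \<le> q u" for u by (simp add: supporting_functionals_def)
    have "norm \<xi> \<le> (\<Sum>b\<in>Basis. \<bar>\<xi> \<bullet> b\<bar>)" by (rule norm_le_l1)
    also have "\<dots> \<le> (\<Sum>b\<in>Basis. \<bar>q b\<bar> + \<bar>q (- b)\<bar>)"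
    proof (rule sum_mono)
      fix b :: 'e
      show "\<bar>\<xi> \<bullet> b\<bar> \<le> \<bar>q b\<bar> + \<bar>q (- b)\<bar>" using u[of b] u[of "- b"] by simp
    qed
    finally show "norm \<xi> \<le> (\<Sum>b\<in>Basis. \<bar>q b\<bar> + \<bar>q (- b)\<bar>)" .
  qed
  ultimately show ?thesis by (simp add: compact_eq_bounded_closed)
qed

text \<open>If \<open>a\<close> has positive inner product with the whole hull, then every \<open>q i\<close>, being attained by one of
  its supporting functionals, is negative at \<open>- a\<close>.\<close>

lemma zero_in_hull_of_supporting_functionals:
  fixes q :: "'i \<Rightarrow> 'e::euclidean_space \<Rightarrow> real"
  assumes "finite I" and q: "\<And>i. i \<in> I \<Longrightarrow> sublinear (q i)"
    and max: "\<And>v. \<exists>i\<in>I. 0 \<le> q i v"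
  shows "0 \<in> convex hull (\<Union>i\<in>I. supporting_functionals (q i))"
proof (rule ccontr)
  let ?C = "convex hull (\<Union>i\<in>I. supporting_functionals (q i))"
  assume "0 \<notin> ?C"
  moreover have "closed ?C"
    by (intro compact_imp_closed compact_convex_hull compact_UN assms(1) ballI
          compact_supporting_functionals)
  ultimately obtain a b where b: "0 < b" "\<And>\<xi>. \<xi> \<in> ?C \<Longrightarrow> b < a \<bullet> \<xi>"
    using separating_hyperplane_closed_0[OF convex_convex_hull] by blast
  obtain i where i: "i \<in> I" "0 \<le> q i (- a)" using max by blast
  obtain \<xi> where "\<xi> \<in> supporting_functionals (q i)" "\<xi> \<bullet> (- a) = q i (- a)"
    using sublinear_attained[OF q[OF i(1)]] by blast
  moreover have "\<xi> \<in> ?C" using calculation i by (auto intro: hull_inc)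
  ultimately show False using b(1) b(2)[of \<xi>] i by (simp add: inner_commute)
qed

text \<open>Riesz representation relative to the inner product of the type. The subdifferential is formed
  with the metric at the base point; the map \<open>A\<close> carries it to a set of functionals described by the
  inner product of the type, and being linear it commutes with convex hulls.\<close>

lemma inner_product_representation:
  fixes B :: "'e::euclidean_space \<Rightarrow> 'e \<Rightarrow> real"
  assumes B: "inner_product B"
  obtains A where "linear A" "bij A" "\<And>\<zeta> u. B \<zeta> u = A \<zeta> \<bullet> u"
proof -
  have lin: "linear (\<lambda>\<zeta>. B \<zeta> u)" "linear (B \<zeta>)" for u \<zeta>
    using B by (auto simp: inner_product_def bilinear_def)
  define A where "A \<zeta> = (\<Sum>b\<in>Basis. B \<zeta> b *\<^sub>R b)" for \<zeta>
  have eq: "B \<zeta> u = A \<zeta> \<bullet> u" for \<zeta> u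
  proof -
    have "B \<zeta> u = B \<zeta> (\<Sum>b\<in>Basis. (u \<bullet> b) *\<^sub>R b)" by (simp add: euclidean_representation)
    also have "\<dots> = (\<Sum>b\<in>Basis. (u \<bullet> b) * B \<zeta> b)"
      by (simp add: linear_sum[OF lin(2)] linear_scale[OF lin(2)])
    also have "\<dots> = A \<zeta> \<bullet> u"
      by (simp add: A_def inner_sum_left inner_commute[of u] mult.commute)
    finally show ?thesis .
  qed
  have "linear A"
    by (rule linearI)
      (simp_all add: A_def linear_add[OF lin(1)] linear_scale[OF lin(1)] sum.distrib
        scaleR_left_distrib scaleR_sum_right)
  moreover have "inj A"
  proof (subst linear_injective_0[OF \<open>linear A\<close>], intro allI impI)
    fix \<zeta> assume "A \<zeta> = 0"
    then have "B \<zeta> \<zeta> = 0" by (simp add: eq)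
    then show "\<zeta> = 0" using B by (auto simp: inner_product_def)
  qed
  ultimately have "bij A"
    by (simp add: bij_def linear_injective_imp_surjective)
  with \<open>linear A\<close> eq that show ?thesis by blast
qed

section \<open>The Clarke derivative of a Lipschitz function\<close>

abbreviation (input) clarke_filter :: "'a::real_normed_vector \<Rightarrow> ('a \<times> real) filter" where
  "clarke_filter x \<equiv> nhds x \<times>\<^sub>F at_right 0"

text \<open>The base point of the difference quotient may be moved along the direction of another one. This is
  why the limit superior over all nearby base points is subadditive, which a directional derivative
  at a fixed base point need not be.\<close>

lemma clarke_shift:
  "filterlim (\<lambda>(y, t). (y + t *\<^sub>R u, t)) (clarke_filter x) (clarke_filter x)"
proof -
  have fst: "(fst \<longlongrightarrow> x) (clarke_filter x)" by (rule filterlim_fst)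
  have snd: "filterlim snd (at_right 0) (clarke_filter x)" by (rule filterlim_snd)
  then have "(snd \<longlongrightarrow> 0) (clarke_filter x)" by (auto simp: filterlim_at)
  then have "((\<lambda>p. fst p + snd p *\<^sub>R u) \<longlongrightarrow> x + 0 *\<^sub>R u) (clarke_filter x)"
    by (intro tendsto_intros fst)
  then show ?thesis
    using filterlim_Pair[OF _ snd] by (simp add: case_prod_unfold)
qed

lemma clarke_rescale:
  assumes "c > 0"
  shows "filterlim (\<lambda>(y, t). (y, c * t)) (clarke_filter x) (clarke_filter x)"
proof -
  have snd: "filterlim snd (at_right 0) (clarke_filter x)" by (rule filterlim_snd)
  have "((\<lambda>t. c * t) \<longlongrightarrow> c * 0) (at_right 0)" by (intro tendsto_intros)
  moreover have "eventually (\<lambda>t. 0 < c * t) (at_right 0)"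
    using assms by (simp add: eventually_at_filter)
  ultimately have "filterlim (\<lambda>t. c * t) (at_right 0) (at_right 0)"
    by (auto simp: filterlim_at elim: eventually_mono)
  from filterlim_compose[OF this snd] show ?thesis
    using filterlim_Pair[OF filterlim_fst] by (simp add: case_prod_unfold)
qed

lemma clarke_filter_positive: "eventually (\<lambda>p. 0 < snd p) (clarke_filter x)"
proof -
  have "eventually (\<lambda>t::real. 0 < t) (at_right 0)" by (simp add: eventually_at_filter)
  then show ?thesis
    using filterlim_snd[of "at_right (0::real)" "nhds x"] by (simp add: filterlim_iff)
qed

lemma clarke_derivative_less:
  assumes "clarke_derivative \<phi> x v < ereal a"
  shows "eventually (\<lambda>(z, t). 0 < t \<and> \<phi> (z + t *\<^sub>R v) - \<phi> z < a * t) (clarke_filter x)"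
proof -
  have "eventually (\<lambda>p. ereal ((\<phi> (fst p + snd p *\<^sub>R v) - \<phi> (fst p)) / snd p) < ereal a)
      (clarke_filter x)"
    using Limsup_lessD[OF assms[unfolded clarke_derivative_def]] by (simp add: case_prod_unfold)
  with clarke_filter_positive show ?thesis
    by eventually_elim (auto simp: case_prod_unfold field_simps)
qed

lemma clarke_derivative_le:
  assumes "eventually (\<lambda>(z, t). \<phi> (z + t *\<^sub>R v) - \<phi> z \<le> a * t) (clarke_filter x)"
  shows "clarke_derivative \<phi> x v \<le> ereal a"
  unfolding clarke_derivative_def
proof (rule Limsup_bounded)
  from assms clarke_filter_positive show "eventually
      (\<lambda>p. (case p of (z, t) \<Rightarrow> ereal ((\<phi> (z + t *\<^sub>R v) - \<phi> z) / t)) \<le> ereal a) (clarke_filter x)"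
    by eventually_elim (auto simp: case_prod_unfold field_simps)
qed

text \<open>The step from \<open>z\<close> to \<open>z + t (u + v)\<close> is the step along \<open>u\<close> from \<open>z\<close> followed by the step along \<open>v\<close>
  from the shifted base point \<open>z + t u\<close>. The bounds are real and strict so that infinite values
  need no separate treatment.\<close>

lemma clarke_derivative_subadditive:
  assumes "clarke_derivative \<phi> x u < ereal a" "clarke_derivative \<phi> x v < ereal b"
  shows "clarke_derivative \<phi> x (u + v) \<le> ereal (a + b)"
proof (rule clarke_derivative_le)
  have "eventually (\<lambda>p. case (case p of (z, t) \<Rightarrow> (z + t *\<^sub>R u, t)) of (z, t) \<Rightarrow>
      0 < t \<and> \<phi> (z + t *\<^sub>R v) - \<phi> z < b * t) (clarke_filter x)"
    using clarke_derivative_less[OF assms(2)] clarke_shift[of u x]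
    unfolding filterlim_iff by blast
  with clarke_derivative_less[OF assms(1)]
  show "eventually (\<lambda>(z, t). \<phi> (z + t *\<^sub>R (u + v)) - \<phi> z \<le> (a + b) * t) (clarke_filter x)"
    by eventually_elim (auto simp: algebra_simps)
qed

text \<open>The inequality suffices for homogeneity, since it can be applied to \<open>1 / c\<close> as well.\<close>

lemma clarke_derivative_scale_le:
  assumes "clarke_derivative \<phi> x v < ereal a" "c > 0"
  shows "clarke_derivative \<phi> x (c *\<^sub>R v) \<le> ereal (c * a)"
proof (rule clarke_derivative_le)
  have "eventually (\<lambda>p. case (case p of (z, t) \<Rightarrow> (z, c * t)) of (z, t) \<Rightarrow>
      0 < t \<and> \<phi> (z + t *\<^sub>R v) - \<phi> z < a * t) (clarke_filter x)"
    using clarke_derivative_less[OF assms(1)] clarke_rescale[OF assms(2), of x]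
    unfolding filterlim_iff by blast
  then show "eventually (\<lambda>(z, t). \<phi> (z + t *\<^sub>R c *\<^sub>R v) - \<phi> z \<le> c * a * t) (clarke_filter x)"
    by eventually_elim (auto simp: algebra_simps)
qed

lemma clarke_derivative_bound:
  assumes "r > 0" and lip: "L-lipschitz_on (ball x r) \<phi>"
  shows "\<bar>clarke_derivative \<phi> x v\<bar> \<le> ereal (L * norm v)"
proof -
  have "eventually (\<lambda>p. fst p \<in> ball x r) (clarke_filter x)"
    using \<open>r > 0\<close>
    by (intro eventually_compose_filterlim[OF _ filterlim_fst] eventually_nhds_in_open) auto
  moreover from this have "eventually (\<lambda>p. fst (case p of (z, t) \<Rightarrow> (z + t *\<^sub>R v, t)) \<in> ball x r) (clarke_filter x)"
    using clarke_shift[of v x] unfolding filterlim_iff by blast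
  moreover note clarke_filter_positive[of x]
  ultimately have ev: "eventually (\<lambda>(z, t). \<bar>(\<phi> (z + t *\<^sub>R v) - \<phi> z) / t\<bar> \<le> L * norm v) (clarke_filter x)"
  proof eventually_elim
    case (elim p)
    obtain z t where p: "p = (z, t)" by fastforce
    have "dist (\<phi> (z + t *\<^sub>R v)) (\<phi> z) \<le> L * dist (z + t *\<^sub>R v) z"
      using elim by (intro lipschitz_onD[OF lip]) (auto simp: p)
    then show ?case using elim by (simp add: p dist_norm field_simps abs_mult)
  qed
  have "clarke_derivative \<phi> x v \<le> ereal (L * norm v)"
    unfolding clarke_derivative_def
    by (rule Limsup_bounded)
      (use ev in \<open>auto simp: abs_le_iff simp del: abs_divide elim!: eventually_mono\<close>)
  moreover have "ereal (- (L * norm v)) \<le> clarke_derivative \<phi> x v"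
    unfolding clarke_derivative_def
  proof (rule le_Limsup)
    show "clarke_filter x \<noteq> bot" by (simp add: prod_filter_eq_bot)
  qed (use ev in \<open>auto simp: abs_le_iff simp del: abs_divide elim!: eventually_mono\<close>)
  ultimately show ?thesis
    by (cases "clarke_derivative \<phi> x v") auto
qed

lemma clarke_derivative_sublinear:
  assumes "r > 0" and "L-lipschitz_on (ball x r) \<phi>"
  obtains q where "sublinear q" "\<And>v. clarke_derivative \<phi> x v = ereal (q v)"
proof -
  define q where "q v = real_of_ereal (clarke_derivative \<phi> x v)" for v
  have q: "clarke_derivative \<phi> x v = ereal (q v)" for v
    using clarke_derivative_bound[OF assms, of v]
    by (cases "clarke_derivative \<phi> x v") (auto simp: q_def)
  have add: "q (u + v) \<le> q u + q v" for u v
  proof (rule field_le_epsilon)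
    fix e :: real assume "e > 0"
    then have "clarke_derivative \<phi> x (u + v) \<le> ereal ((q u + e / 2) + (q v + e / 2))"
      by (intro clarke_derivative_subadditive) (auto simp: q)
    then show "q (u + v) \<le> q u + q v + e" by (simp add: q)
  qed
  have scale_le: "q (c *\<^sub>R v) \<le> c * q v" if "c > 0" for c v
  proof (rule field_le_epsilon)
    fix e :: real assume "e > 0"
    then have "clarke_derivative \<phi> x (c *\<^sub>R v) \<le> ereal (c * (q v + e / c))"
      using that by (intro clarke_derivative_scale_le) (auto simp: q)
    then show "q (c *\<^sub>R v) \<le> c * q v + e" using that by (simp add: q algebra_simps)
  qed
  have "q (c *\<^sub>R v) = c * q v" if "c > 0" for c v
    using scale_le[OF that, of v] scale_le[of "1 / c" "c *\<^sub>R v"] that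
    by (simp add: field_simps)
  with add have "sublinear q" by (simp add: sublinear_def)
  with q that show ?thesis by blast
qed

text \<open>Constant base points are among those considered by the limit superior.\<close>

lemma clarke_derivative_negative_descent:
  assumes "clarke_derivative \<phi> x v < 0"
  shows "eventually (\<lambda>t. \<phi> (x + t *\<^sub>R v) < \<phi> x) (at_right 0)"
proof -
  have "eventually (\<lambda>(z, t). 0 < t \<and> \<phi> (z + t *\<^sub>R v) - \<phi> z < 0 * t) (clarke_filter x)"
    by (rule clarke_derivative_less) (use assms in \<open>simp add: zero_ereal_def\<close>)
  then obtain P Q where "eventually P (nhds x)" "eventually Q (at_right 0)"
      "\<And>z t. P z \<Longrightarrow> Q t \<Longrightarrow> \<phi> (z + t *\<^sub>R v) - \<phi> z < 0"
    unfolding eventually_prod_filter by auto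
  then show ?thesis
    by (auto elim!: eventually_mono dest: eventually_nhds_x_imp_x)
qed

text \<open>Every direction has a nonnegative Clarke derivative for some \<open>i\<close>, since otherwise a short step in
  that direction would decrease all functions at once.\<close>

lemma zero_in_hull_of_clarke_subdifferentials:
  fixes \<phi> :: "'i \<Rightarrow> 'e::euclidean_space \<Rightarrow> real"
  assumes B: "inner_product B" and "finite I"
    and lip: "\<And>i. i \<in> I \<Longrightarrow> \<exists>r>0. \<exists>L. L-lipschitz_on (ball x r) (\<phi> i)"
    and opt: "eventually (\<lambda>y. \<exists>i\<in>I. \<phi> i x \<le> \<phi> i y) (nhds x)"
  shows "0 \<in> convex hull (\<Union>i\<in>I. clarke_subdifferential B (\<phi> i) x)"
proof -
  have "\<forall>i\<in>I. \<exists>q. sublinear q \<and> (\<forall>v. clarke_derivative (\<phi> i) x v = ereal (q v))"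
    using lip by (metis clarke_derivative_sublinear)
  then obtain q where q: "\<And>i. i \<in> I \<Longrightarrow> sublinear (q i)"
      "\<And>i v. i \<in> I \<Longrightarrow> clarke_derivative (\<phi> i) x v = ereal (q i v)"
    by metis
  have "\<exists>i\<in>I. 0 \<le> q i v" for v
  proof (rule ccontr)
    assume "\<not> (\<exists>i\<in>I. 0 \<le> q i v)"
    then have "\<forall>i\<in>I. eventually (\<lambda>t. \<phi> i (x + t *\<^sub>R v) < \<phi> i x) (at_right 0)"
      by (intro ballI clarke_derivative_negative_descent) (auto simp: q)
    then have "eventually (\<lambda>t. \<forall>i\<in>I. \<phi> i (x + t *\<^sub>R v) < \<phi> i x) (at_right 0)"
      using \<open>finite I\<close> by (simp add: eventually_ball_finite)
    moreover have "eventually (\<lambda>t. \<exists>i\<in>I. \<phi> i x \<le> \<phi> i (x + t *\<^sub>R v)) (at_right 0)"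
    proof -
      have "((\<lambda>t. x + t *\<^sub>R v) \<longlongrightarrow> x + 0 *\<^sub>R v) (at_right 0)" by (intro tendsto_intros)
      then have "filterlim (\<lambda>t. x + t *\<^sub>R v) (nhds x) (at_right 0)" by simp
      from eventually_compose_filterlim[OF opt this] show ?thesis .
    qed
    ultimately have "eventually (\<lambda>t::real. False) (at_right 0)"
      by eventually_elim (auto simp: not_less[symmetric])
    then show False by simp
  qed
  then have zero: "0 \<in> convex hull (\<Union>i\<in>I. supporting_functionals (q i))"
    using \<open>finite I\<close> q(1) by (intro zero_in_hull_of_supporting_functionals)
  (* Transport the conclusion from the inner product of the type to B. *)
  obtain A where A: "linear A" "bij A" "\<And>\<zeta> u. B \<zeta> u = A \<zeta> \<bullet> u"
    using inner_product_representation[OF B] by blast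
  have sub: "A ` clarke_subdifferential B (\<phi> i) x = supporting_functionals (q i)" if "i \<in> I" for i
  proof -
    have "clarke_subdifferential B (\<phi> i) x = A -` supporting_functionals (q i)"
      using that by (auto simp: clarke_subdifferential_def supporting_functionals_def A(3) q(2))
    then show ?thesis using A(2) by (simp add: bij_is_surj surj_image_vimage_eq)
  qed
  have "A ` (convex hull (\<Union>i\<in>I. clarke_subdifferential B (\<phi> i) x)) =
      convex hull (\<Union>i\<in>I. supporting_functionals (q i))"
    using sub by (simp add: convex_hull_linear_image[OF A(1)] image_UN)
  then obtain \<zeta> where "\<zeta> \<in> convex hull (\<Union>i\<in>I. clarke_subdifferential B (\<phi> i) x)" "A \<zeta> = 0"
    using zero by (metis imageE)
  then show ?thesis
    using A(1,2) linear_0[OF A(1)] by (metis bij_is_inj injD)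
qed

section \<open>The retraction is locally Lipschitz in coordinates\<close>

lemma chart_inv_chart: "is_chart c \<Longrightarrow> p \<in> fst c \<Longrightarrow> chart_inv c (snd c p) = p"
  by (simp add: is_chart_def homeomorphism_def)

lemma smooth_on_imp_Ck_on: "smooth_on S f \<Longrightarrow> Ck_on k S f"
  by (simp add: smooth_on_def)

lemma manifold_charts:
  assumes "riemannian_manifold M"
  shows "c \<in> atlas M \<Longrightarrow> is_chart c" "chart_at M p \<in> atlas M" "p \<in> fst (chart_at M p)"
  using assms by (auto simp: riemannian_manifold_def smooth_atlas_def)

text \<open>In these coordinates a tangent vector at \<open>p\<close> is read in the chart \<open>chart_at M p\<close>, so
  \<open>tangent_vec\<close> is the derivative of a transition map, which exists by compatibility of the
  atlas.\<close>

lemma transition_has_derivative: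
  assumes M: "riemannian_manifold M" and c: "c \<in> atlas M" "p \<in> fst c"
  shows "(snd (chart_at M p) \<circ> chart_inv c has_derivative tangent_vec M c (snd c p))
      (at (snd c p))"
proof -
  let ?d = "chart_at M p"
  have "smooth_on (snd c ` (fst c \<inter> fst ?d)) (snd ?d \<circ> chart_inv c)"
    using M c manifold_charts(2)[OF M] by (auto simp: riemannian_manifold_def smooth_atlas_def)
  then have "Ck_on (Suc 0) (snd c ` (fst c \<inter> fst ?d)) (snd ?d \<circ> chart_inv c)"
    by (rule smooth_on_imp_Ck_on)
  then have "(snd ?d \<circ> chart_inv c) differentiable (at (snd c p))"
    using c manifold_charts(3)[OF M] by auto
  then show ?thesis
    using chart_inv_chart[OF manifold_charts(1)[OF M c(1)] c(2)]
    by (simp add: frechet_derivative_works tangent_vec_def[abs_def])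
qed

text \<open>The bundle chart induced by the preferred chart at \<open>x\<close> is the identity on the fibre over \<open>x\<close>.
  Through this fibre, smoothness of the retraction on the tangent bundle gives smoothness of \<open>R x\<close>.\<close>

lemma tangent_param_chart_at:
  assumes M: "riemannian_manifold M"
  shows "tangent_param M (chart_at M x) (snd (chart_at M x) x, w) = (x, w)"
proof -
  let ?c = "chart_at M x"
  note ch = manifold_charts[OF M]
  have c: "is_chart ?c" using ch by blast
  have "((\<lambda>z. z) has_derivative (\<lambda>v. v)) (at (snd ?c x))" by simp
  then have "(snd ?c \<circ> chart_inv ?c has_derivative (\<lambda>v. v)) (at (snd ?c x))"
  proof (rule has_derivative_transform_within_open)
    show "open (chart_range ?c)" using c by (simp add: is_chart_def)
    show "snd ?c x \<in> chart_range ?c" using ch(3) by auto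
  qed (auto simp: chart_inv_chart[OF c])
  moreover have "(snd ?c \<circ> chart_inv ?c has_derivative tangent_vec M ?c (snd ?c x)) (at (snd ?c x))"
    using transition_has_derivative[OF M ch(2) ch(3)] by simp
  ultimately have "tangent_vec M ?c (snd ?c x) = (\<lambda>v. v)"
    by (rule has_derivative_unique[symmetric])
  then show ?thesis
    by (simp add: tangent_param_def chart_inv_chart[OF c ch(3)])
qed

lemma retraction_continuous:
  assumes M: "riemannian_manifold M" and R: "riemannian_retraction M R"
  shows "continuous_on UNIV (R x)"
proof -
  let ?c = "chart_at M x"
  have "continuous_on (chart_range ?c \<times> UNIV) (case_prod R \<circ> tangent_param M ?c)"
    using R manifold_charts(2)[OF M] by (auto simp: riemannian_retraction_def)
  then have "continuous_on UNIV (\<lambda>w. (case_prod R \<circ> tangent_param M ?c) (snd ?c x, w))"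
    by (rule continuous_on_compose2)
      (use manifold_charts(3)[OF M] in \<open>auto intro!: continuous_intros\<close>)
  then show ?thesis by (simp add: tangent_param_chart_at[OF M])
qed

lemma retraction_C1:
  assumes M: "riemannian_manifold M" and R: "riemannian_retraction M R" and d: "d \<in> atlas M"
  shows "Ck_on (Suc 0) {w. R x w \<in> fst d} (snd d \<circ> R x)"
proof -
  let ?c = "chart_at M x"
  define z where "z = snd ?c x"
  define G where "G = snd d \<circ> case_prod R \<circ> tangent_param M ?c"
  define S where "S = {zw \<in> chart_range ?c \<times> UNIV. case_prod R (tangent_param M ?c zw) \<in> fst d}"
  have "smooth_on S G"
    using R d manifold_charts(2)[OF M] by (auto simp: riemannian_retraction_def S_def G_def)
  then have G: "Ck_on (Suc 0) S G" by (rule smooth_on_imp_Ck_on)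
  have S: "(z, w) \<in> S \<longleftrightarrow> R x w \<in> fst d" for w
    using manifold_charts(3)[OF M] by (auto simp: S_def z_def tangent_param_chart_at[OF M])
  have slice: "snd d \<circ> R x = G \<circ> Pair z"
    by (auto simp: G_def z_def tangent_param_chart_at[OF M])
  have der: "(snd d \<circ> R x has_derivative (\<lambda>v. frechet_derivative G (at (z, w)) (0, v))) (at w)"
    if "R x w \<in> fst d" for w
  proof -
    have "(G has_derivative frechet_derivative G (at (z, w))) (at (z, w))"
      using G S that by (simp add: frechet_derivative_works)
    moreover have "(Pair z has_derivative (\<lambda>v. (0, v))) (at w)"
      by (intro derivative_eq_intros) auto
    ultimately show ?thesis
      unfolding slice using diff_chain_at[of "Pair z" "\<lambda>v. (0, v)" w G] by (simp add: o_def)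
  qed
  have "continuous_on {w. R x w \<in> fst d} (\<lambda>w. frechet_derivative G (at (z, w)) (0, v))" for v
  proof (rule continuous_on_compose2[where f = "Pair z"])
    show "continuous_on S (\<lambda>zw. frechet_derivative G (at zw) (0, v))" using G by simp
  qed (auto simp: S intro!: continuous_intros)
  then have "continuous_on {w. R x w \<in> fst d} (\<lambda>w. frechet_derivative (snd d \<circ> R x) (at w) v)" for v
    by (rule continuous_on_cong[THEN iffD1, rotated -1])
      (auto simp: frechet_derivative_at[OF der, symmetric])
  then show ?thesis using der by (auto simp: differentiable_def)
qed

lemma retraction_chart_derivative:
  assumes "riemannian_manifold M" "riemannian_retraction M R" "d \<in> atlas M" "R x w \<in> fst d"
  shows "(snd d \<circ> R x has_derivative frechet_derivative (snd d \<circ> R x) (at w)) (at w)"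
  using retraction_C1[OF assms(1-3), of x] assms(4) by (simp add: frechet_derivative_works)

lemma retracted_segment_derivative:
  assumes "riemannian_manifold M" "riemannian_retraction M R" "d \<in> atlas M"
    and "R x (\<xi> + t *\<^sub>R v) \<in> fst d" and "a < b" "t \<in> {a..b}"
  shows "(snd d \<circ> (\<lambda>t. R x (\<xi> + t *\<^sub>R v))) differentiable (at t within {a..b})"
    and "vector_derivative (snd d \<circ> (\<lambda>t. R x (\<xi> + t *\<^sub>R v))) (at t within {a..b}) =
      frechet_derivative (snd d \<circ> R x) (at (\<xi> + t *\<^sub>R v)) v"
proof -
  have "((\<lambda>t. \<xi> + t *\<^sub>R v) has_derivative (\<lambda>h. h *\<^sub>R v)) (at t within {a..b})"
    by (auto intro!: derivative_eq_intros)
  from has_derivative_compose[OF this retraction_chart_derivative[OF assms(1-4)]]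
  have "(snd d \<circ> (\<lambda>t. R x (\<xi> + t *\<^sub>R v)) has_derivative
      (\<lambda>h. frechet_derivative (snd d \<circ> R x) (at (\<xi> + t *\<^sub>R v)) (h *\<^sub>R v))) (at t within {a..b})"
    by (simp add: o_def)
  moreover have "linear (frechet_derivative (snd d \<circ> R x) (at (\<xi> + t *\<^sub>R v)))"
    using retraction_chart_derivative[OF assms(1-4)] by (rule has_derivative_linear)
  ultimately have "(snd d \<circ> (\<lambda>t. R x (\<xi> + t *\<^sub>R v)) has_vector_derivative
      frechet_derivative (snd d \<circ> R x) (at (\<xi> + t *\<^sub>R v)) v) (at t within {a..b})"
    by (simp add: has_vector_derivative_def linear_scale)
  then show "(snd d \<circ> (\<lambda>t. R x (\<xi> + t *\<^sub>R v))) differentiable (at t within {a..b})"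
    and "vector_derivative (snd d \<circ> (\<lambda>t. R x (\<xi> + t *\<^sub>R v))) (at t within {a..b}) =
      frechet_derivative (snd d \<circ> R x) (at (\<xi> + t *\<^sub>R v)) v"
    using assms(5,6)
    by (auto simp: has_vector_derivative_def intro: differentiableI
        intro!: vector_derivative_within_closed_interval)
qed

text \<open>Continuous differentiability has to hold in every chart of the atlas. The retraction is smooth in
  each of them, so no change of charts is needed and no break points occur.\<close>

lemma piecewise_C1_retracted_segment:
  assumes M: "riemannian_manifold M" and R: "riemannian_retraction M R"
  shows "piecewise_C1_curve M (\<lambda>t. R x (\<xi> + t *\<^sub>R v))"
proof -
  have cont: "continuous_on I (\<lambda>t. R x (\<xi> + t *\<^sub>R v))" for I
    by (rule continuous_on_compose2[OF retraction_continuous[OF M R]])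
      (auto intro!: continuous_intros)
  have "C1_curve_on M {a..b} (\<lambda>t. R x (\<xi> + t *\<^sub>R v))" if "a < b" for a b
    unfolding C1_curve_on_def
  proof (intro conjI ballI impI)
    fix d t assume "d \<in> atlas M" "t \<in> {a..b}" "R x (\<xi> + t *\<^sub>R v) \<in> fst d"
    then show "(snd d \<circ> (\<lambda>t. R x (\<xi> + t *\<^sub>R v))) differentiable (at t within {a..b})"
      using retracted_segment_derivative(1)[OF M R] that by blast
  next
    fix d assume d: "d \<in> atlas M"
    let ?J = "{t \<in> {a..b}. R x (\<xi> + t *\<^sub>R v) \<in> fst d}"
    have "continuous_on ?J (\<lambda>t. frechet_derivative (snd d \<circ> R x) (at (\<xi> + t *\<^sub>R v)) v)"
    proof (rule continuous_on_compose2[where f = "\<lambda>t. \<xi> + t *\<^sub>R v"])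
      show "continuous_on {w. R x w \<in> fst d} (\<lambda>w. frechet_derivative (snd d \<circ> R x) (at w) v)"
        using retraction_C1[OF M R d] by simp
    qed (auto intro!: continuous_intros)
    then show "continuous_on ?J
        (\<lambda>t. vector_derivative (snd d \<circ> (\<lambda>t. R x (\<xi> + t *\<^sub>R v))) (at t within {a..b}))"
      by (rule continuous_on_cong[THEN iffD1, rotated -1])
        (auto simp: retracted_segment_derivative(2)[OF M R d _ that] simp del: o_apply)
  qed (rule cont)
  then show ?thesis unfolding piecewise_C1_curve_def using cont by blast
qed

lemma linear_norm_le_sum_Basis:
  fixes T :: "'a::euclidean_space \<Rightarrow> 'b::real_normed_vector"
  assumes "linear T"
  shows "norm (T v) \<le> (\<Sum>b\<in>Basis. norm (T b)) * norm v"
proof -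
  have "T v = T (\<Sum>b\<in>Basis. (v \<bullet> b) *\<^sub>R b)" by (simp add: euclidean_representation)
  also have "\<dots> = (\<Sum>b\<in>Basis. (v \<bullet> b) *\<^sub>R T b)"
    by (simp add: linear_sum[OF assms] linear_scale[OF assms])
  also have "norm \<dots> \<le> (\<Sum>b\<in>Basis. norm (T b) * norm v)"
    by (rule sum_norm_le) (simp add: mult.commute[of _ "norm v"] Basis_le_norm mult_right_mono)
  finally show ?thesis by (simp add: sum_distrib_right)
qed

lemma bilinear_le_sum_Basis:
  fixes B :: "'a::euclidean_space \<Rightarrow> 'a \<Rightarrow> real"
  assumes "bilinear B"
  shows "B v v \<le> (\<Sum>(b, c)\<in>Basis \<times> Basis. \<bar>B b c\<bar>) * (norm v)\<^sup>2"
proof -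
  have "B v v = B (\<Sum>b\<in>Basis. (v \<bullet> b) *\<^sub>R b) (\<Sum>b\<in>Basis. (v \<bullet> b) *\<^sub>R b)"
    by (simp add: euclidean_representation)
  also have "\<dots> = (\<Sum>(b, c)\<in>Basis \<times> Basis. (v \<bullet> c) * ((v \<bullet> b) * B b c))"
    by (simp add: bilinear_sum[OF assms] bilinear_lmul[OF assms] bilinear_rmul[OF assms])
  also have "\<dots> \<le> (\<Sum>(b, c)\<in>Basis \<times> Basis. \<bar>B b c\<bar> * (norm v)\<^sup>2)"
  proof (rule sum_mono, clarify)
    fix b c :: 'a assume bc: "b \<in> Basis" "c \<in> Basis"
    have "(v \<bullet> c) * ((v \<bullet> b) * B b c) \<le> \<bar>v \<bullet> c\<bar> * \<bar>v \<bullet> b\<bar> * \<bar>B b c\<bar>"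
      by (metis abs_ge_self abs_mult mult.assoc)
    also have "\<dots> \<le> (norm v * norm v) * \<bar>B b c\<bar>"
      using bc by (intro mult_right_mono mult_mono) (auto simp: Basis_le_norm)
    finally show "(v \<bullet> c) * ((v \<bullet> b) * B b c) \<le> \<bar>B b c\<bar> * (norm v)\<^sup>2"
      by (simp add: power2_eq_square mult.commute)
  qed
  finally show ?thesis by (simp add: sum_distrib_right case_prod_unfold)
qed

lemma compact_continuous_upper_bound:
  fixes g :: "'a::topological_space \<Rightarrow> real"
  assumes "compact K" "continuous_on K g"
  obtains C where "C > 0" "\<And>x. x \<in> K \<Longrightarrow> g x \<le> C"
proof -
  have "bounded (g ` K)" using assms by (intro compact_imp_bounded compact_continuous_image)
  then obtain C where "C > 0" "\<forall>y\<in>g ` K. norm y \<le> C" by (metis bounded_pos)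
  then show ?thesis using that[of C] by (metis abs_le_D1 imageI real_norm_def)
qed

text \<open>The velocity of a curve is read in a chart that varies irregularly with the point. Expressing it
  through a single chart \<open>c\<close> makes the continuity of the metric coefficients available.\<close>

lemma chart_change_of_retraction_derivative:
  assumes M: "riemannian_manifold M" and R: "riemannian_retraction M R"
    and c: "c \<in> atlas M" "R x w \<in> fst c"
  shows "frechet_derivative (snd (chart_at M (R x w)) \<circ> R x) (at w) v =
    tangent_vec M c (snd c (R x w)) (frechet_derivative (snd c \<circ> R x) (at w) v)"
proof -
  let ?d = "chart_at M (R x w)"
  have ch: "is_chart c" using manifold_charts(1)[OF M c(1)] .
  have "((snd ?d \<circ> chart_inv c) \<circ> (snd c \<circ> R x) has_derivative
      tangent_vec M c (snd c (R x w)) \<circ> frechet_derivative (snd c \<circ> R x) (at w)) (at w)"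
    using transition_has_derivative[OF M c]
    by (intro diff_chain_at retraction_chart_derivative[OF M R c]) simp
  then have "(snd ?d \<circ> R x has_derivative
      tangent_vec M c (snd c (R x w)) \<circ> frechet_derivative (snd c \<circ> R x) (at w)) (at w)"
  proof (rule has_derivative_transform_within_open)
    show "open (R x -` fst c)"
      using ch retraction_continuous[OF M R] by (simp add: is_chart_def open_vimage)
  qed (use c in \<open>auto simp: chart_inv_chart[OF ch]\<close>)
  from frechet_derivative_at[OF this] show ?thesis by (metis o_apply)
qed

text \<open>The squared norm is a quadratic form in \<open>v\<close> whose coefficients, computed in the chart at \<open>x\<close>, are
  continuous in \<open>w\<close>; they are bounded on a compact ball that \<open>R x\<close> maps into the chart domain.\<close>

lemma retraction_speed_bound:
  fixes M :: "('m::{t2_space, second_countable_topology}, 'e::euclidean_space) riemannian"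
  assumes M: "riemannian_manifold M" and R: "riemannian_retraction M R"
  obtains r C where "r > 0" "C > 0"
    "\<And>w v. w \<in> ball 0 r \<Longrightarrow> tangent_norm M (R x w)
        (frechet_derivative (snd (chart_at M (R x w)) \<circ> R x) (at w) v) \<le> C * norm v"
proof -
  define c where "c = chart_at M x"
  have c: "c \<in> atlas M" "x \<in> fst c" using manifold_charts[OF M] by (auto simp: c_def)
  have ch: "is_chart c" using manifold_charts(1)[OF M c(1)] .
  have R0: "R x 0 = x" using R by (simp add: riemannian_retraction_def)
  define U where "U = {w. R x w \<in> fst c}"
  have "open (R x -` fst c)"
    using ch retraction_continuous[OF M R] by (simp add: is_chart_def open_vimage)
  then have "open U" by (simp add: U_def vimage_def)
  moreover have "0 \<in> U" using c R0 by (simp add: U_def)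
  ultimately obtain r where r: "r > 0" "cball 0 r \<subseteq> U" by (meson open_contains_cball)
  have contU: "continuous_on U (\<lambda>w. snd c (R x w))"
  proof (rule continuous_on_compose2[where f = "R x"])
    show "continuous_on (fst c) (snd c)" using ch by (simp add: is_chart_def homeomorphism_def)
    show "continuous_on U (R x)"
      using retraction_continuous[OF M R] by (rule continuous_on_subset) simp
  qed (auto simp: U_def)
  define g where "g z b b' =
    metric M (chart_inv c z) (tangent_vec M c z b) (tangent_vec M c z b')" for z b b'
  have contg: "continuous_on (chart_range c) (\<lambda>z. g z b b')" for b b'
  proof -
    have "smooth_on (chart_range c) (\<lambda>z. g z b b')"
      using M c by (simp add: riemannian_manifold_def g_def)
    then have "Ck_on 0 (chart_range c) (\<lambda>z. g z b b')" by (rule smooth_on_imp_Ck_on)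
    then show ?thesis by simp
  qed
  have "continuous_on (cball 0 r) (\<lambda>w. g (snd c (R x w)) b b')" for b b'
    by (rule continuous_on_compose2[OF contg continuous_on_subset[OF contU r(2)]])
      (use r in \<open>auto simp: U_def\<close>)
  then have "continuous_on (cball 0 r)
      (\<lambda>w. \<Sum>(b, b')\<in>Basis \<times> Basis. \<bar>g (snd c (R x w)) b b'\<bar>)"
    by (auto simp: case_prod_unfold intro!: continuous_intros)
  then obtain C2 where C2: "C2 > 0" "\<And>w. w \<in> cball 0 r \<Longrightarrow>
      (\<Sum>(b, b')\<in>Basis \<times> Basis. \<bar>g (snd c (R x w)) b b'\<bar>) \<le> C2"
    using compact_continuous_upper_bound[OF compact_cball] by blast
  define D where "D w = frechet_derivative (snd c \<circ> R x) (at w)" for w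
  have "continuous_on U (\<lambda>w. D w b)" for b
    using retraction_C1[OF M R c(1)] by (simp add: U_def D_def)
  then have "continuous_on (cball 0 r) (\<lambda>w. \<Sum>b\<in>Basis. norm (D w b))"
    using r by (intro continuous_intros) (auto intro: continuous_on_subset)
  then obtain C1 where C1: "C1 > 0" "\<And>w. w \<in> cball 0 r \<Longrightarrow> (\<Sum>b\<in>Basis. norm (D w b)) \<le> C1"
    using compact_continuous_upper_bound[OF compact_cball] by blast
  show ?thesis
  proof (rule that[OF r(1)])
    show "sqrt C2 * C1 > 0" using C1 C2 by simp
    fix w v :: 'e assume "w \<in> ball 0 r"
    then have w1: "w \<in> cball 0 r" by simp
    with r(2) have "w \<in> U" by (rule subsetD)
    with w1 have w: "w \<in> cball 0 r" "R x w \<in> fst c" by (simp_all add: U_def)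
    define z where "z = snd c (R x w)"
    have linD: "linear (D w)"
      unfolding D_def by (rule has_derivative_linear, rule retraction_chart_derivative[OF M R c(1) w(2)])
    have linT: "linear (tangent_vec M c z)"
      unfolding z_def by (rule has_derivative_linear, rule transition_has_derivative[OF M c(1) w(2)])
    have bil: "bilinear (metric M p)" for p
      using M by (simp add: riemannian_manifold_def inner_product_def)
    have "bilinear (g z)"
      unfolding bilinear_def g_def
    proof (intro conjI allI)
      fix b
      have "linear (metric M (chart_inv c z) (tangent_vec M c z b))"
        "linear (\<lambda>u. metric M (chart_inv c z) u (tangent_vec M c z b))"
        using bil by (auto simp: bilinear_def)
      then show "linear (\<lambda>b'. metric M (chart_inv c z) (tangent_vec M c z b) (tangent_vec M c z b'))"
        "linear (\<lambda>b'. metric M (chart_inv c z) (tangent_vec M c z b') (tangent_vec M c z b))"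
        using linear_compose[OF linT] by (auto simp: o_def)
    qed
    have "norm (D w v) \<le> (\<Sum>b\<in>Basis. norm (D w b)) * norm v"
      by (rule linear_norm_le_sum_Basis[OF linD])
    also have "\<dots> \<le> C1 * norm v" using C1(2)[OF w(1)] by (rule mult_right_mono) simp
    finally have D: "norm (D w v) \<le> C1 * norm v" .
    have "g z (D w v) (D w v) \<le> (\<Sum>(b, b')\<in>Basis \<times> Basis. \<bar>g z b b'\<bar>) * (norm (D w v))\<^sup>2"
      by (rule bilinear_le_sum_Basis) fact
    also have "\<dots> \<le> C2 * (C1 * norm v)\<^sup>2"
      using C2(2)[OF w(1)] C2(1) D by (intro mult_mono power_mono) (auto simp: z_def)
    finally have "sqrt (g z (D w v) (D w v)) \<le> sqrt (C2 * (C1 * norm v)\<^sup>2)" by simp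
    also have "\<dots> = sqrt C2 * C1 * norm v"
      using C1(1) by (simp add: real_sqrt_mult)
    finally show "tangent_norm M (R x w)
        (frechet_derivative (snd (chart_at M (R x w)) \<circ> R x) (at w) v) \<le> sqrt C2 * C1 * norm v"
      using chart_change_of_retraction_derivative[OF M R c(1) w(2), of v]
      by (simp add: tangent_norm_def g_def z_def D_def chart_inv_chart[OF ch w(2)])
  qed
qed

text \<open>A non-integrable function has integral \<open>0\<close> by convention. Thus a bound on the speed bounds the
  length of a curve without any regularity of the speed.\<close>

lemma integral_unit_interval_le:
  fixes h :: "real \<Rightarrow> real"
  assumes "0 \<le> C" "\<And>t. t \<in> {0..1} \<Longrightarrow> h t \<le> C"
  shows "integral {0..1} h \<le> C"
proof (cases "h integrable_on {0..1}")
  case True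
  then have "integral {0..1} h \<le> integral {0..1::real} (\<lambda>_. C)"
    using assms(2) by (intro integral_le) (auto intro: integrable_const_ivl)
  then show ?thesis by simp
qed (simp add: not_integrable_integral assms(1))

text \<open>The distance is at most the length of the image of the segment from \<open>\<xi>\<close> to \<open>\<eta>\<close>, which stays in
  the ball by convexity.\<close>

lemma retraction_locally_Lipschitz:
  fixes M :: "('m::{t2_space, second_countable_topology}, 'e::euclidean_space) riemannian"
  assumes M: "riemannian_manifold M" and R: "riemannian_retraction M R"
  obtains r C where "r > 0" "C > 0"
    "\<And>\<xi> \<eta>. \<xi> \<in> ball 0 r \<Longrightarrow> \<eta> \<in> ball 0 r \<Longrightarrow> rdist M (R x \<xi>) (R x \<eta>) \<le> ereal (C * dist \<xi> \<eta>)"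
proof -
  obtain r C where rC: "r > 0" "C > 0"
    and speed: "\<And>w v. w \<in> ball 0 r \<Longrightarrow> tangent_norm M (R x w)
        (frechet_derivative (snd (chart_at M (R x w)) \<circ> R x) (at w) v) \<le> C * norm v"
    using retraction_speed_bound[OF M R] by blast
  show ?thesis
  proof (rule that[OF rC])
    fix \<xi> \<eta> :: 'e assume \<xi>\<eta>: "\<xi> \<in> ball 0 r" "\<eta> \<in> ball 0 r"
    define v where "v = \<eta> - \<xi>"
    define \<gamma> where "\<gamma> t = R x (\<xi> + t *\<^sub>R v)" for t
    have "tangent_norm M (\<gamma> t) (velocity M \<gamma> t) \<le> C * norm v" if t: "t \<in> {0..1}" for t
    proof -
      have "(1 - t) *\<^sub>R \<xi> + t *\<^sub>R \<eta> \<in> ball 0 r"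
        using \<xi>\<eta> t by (intro convexD[OF convex_ball]) auto
      then have "\<xi> + t *\<^sub>R v \<in> ball 0 r" by (simp add: v_def algebra_simps)
      from speed[OF this, of v] show ?thesis
        using retracted_segment_derivative(2)[OF M R manifold_charts(2)[OF M, of "\<gamma> t"],
            of x \<xi> t v 0 1] manifold_charts(3)[OF M, of "\<gamma> t"] t
        by (simp add: velocity_def \<gamma>_def[abs_def])
    qed
    then have "curve_length M \<gamma> \<le> C * norm v"
      unfolding curve_length_def using rC(2) by (intro integral_unit_interval_le) auto
    moreover have "rdist M (R x \<xi>) (R x \<eta>) \<le> ereal (curve_length M \<gamma>)"
      unfolding rdist_def
      using piecewise_C1_retracted_segment[OF M R]
      by (intro INF_lower) (auto simp: \<gamma>_def[abs_def] v_def)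
    ultimately show "rdist M (R x \<xi>) (R x \<eta>) \<le> ereal (C * dist \<xi> \<eta>)"
      by (simp add: v_def dist_norm norm_minus_commute order_trans)
  qed
qed

section \<open>Weak Pareto optimality on the manifold\<close>

lemma pullback_locally_Lipschitz:
  fixes M :: "('m::{t2_space, second_countable_topology}, 'e::euclidean_space) riemannian"
  assumes M: "riemannian_manifold M" and R: "riemannian_retraction M R"
    and f: "riemannian_locally_Lipschitz M f"
  shows "\<exists>r>0. \<exists>L. L-lipschitz_on (ball 0 r) (f \<circ> R x)"
proof -
  obtain r C where r: "r > 0" "C > 0"
    and RC: "\<And>\<xi> \<eta>. \<xi> \<in> ball 0 r \<Longrightarrow> \<eta> \<in> ball 0 r \<Longrightarrow>
        rdist M (R x \<xi>) (R x \<eta>) \<le> ereal (C * dist \<xi> \<eta>)"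
    using retraction_locally_Lipschitz[OF M R] by blast
  obtain N L where N: "open N" "x \<in> N" "L > 0"
    and fL: "\<And>z y. z \<in> N \<Longrightarrow> y \<in> N \<Longrightarrow> ereal \<bar>f z - f y\<bar> \<le> ereal L * rdist M z y"
    using f unfolding riemannian_locally_Lipschitz_def by metis
  have "open (R x -` N)" using N(1) retraction_continuous[OF M R] by (simp add: open_vimage)
  moreover have "0 \<in> R x -` N" using R N(2) by (simp add: riemannian_retraction_def)
  ultimately obtain s where s: "s > 0" "ball 0 s \<subseteq> R x -` N" by (meson open_contains_ball)
  have "(L * C)-lipschitz_on (ball 0 (min r s)) (f \<circ> R x)"
  proof (rule lipschitz_onI)
    fix \<xi> \<eta> :: 'e assume \<xi>\<eta>: "\<xi> \<in> ball 0 (min r s)" "\<eta> \<in> ball 0 (min r s)"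
    then have "R x \<xi> \<in> N" "R x \<eta> \<in> N" using s(2) by auto
    then have "ereal \<bar>f (R x \<xi>) - f (R x \<eta>)\<bar> \<le> ereal L * rdist M (R x \<xi>) (R x \<eta>)"
      by (rule fL)
    also have "\<dots> \<le> ereal L * ereal (C * dist \<xi> \<eta>)"
      using \<xi>\<eta> N(3) by (intro ereal_mult_left_mono RC) auto
    finally show "dist ((f \<circ> R x) \<xi>) ((f \<circ> R x) \<eta>) \<le> L * C * dist \<xi> \<eta>"
      by (simp add: dist_real_def mult.assoc)
  qed (use r N in auto)
  then show ?thesis using r(1) s(1) by (metis min_less_iff_conj)
qed

lemma Pareto_pullback:
  fixes M :: "('m::{t2_space, second_countable_topology}, 'e::euclidean_space) riemannian"
  assumes M: "riemannian_manifold M" and R: "riemannian_retraction M R"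
    and opt: "local_weak_Pareto M m f x"
  shows "eventually (\<lambda>\<xi>. \<exists>i\<in>{1..m}. (f i \<circ> R x) 0 \<le> (f i \<circ> R x) \<xi>) (nhds 0)"
proof -
  have R0: "R x 0 = x" using R by (simp add: riemannian_retraction_def)
  obtain \<sigma> where \<sigma>: "\<sigma> > 0"
    and no: "\<not> (\<exists>y\<in>riemannian_ball M x \<sigma>. \<forall>i\<in>{1..m}. f i y < f i x)"
    using opt unfolding local_weak_Pareto_def by blast
  obtain r C where r: "r > 0" "C > 0"
    and RC: "\<And>\<xi> \<eta>. \<xi> \<in> ball 0 r \<Longrightarrow> \<eta> \<in> ball 0 r \<Longrightarrow>
        rdist M (R x \<xi>) (R x \<eta>) \<le> ereal (C * dist \<xi> \<eta>)"
    using retraction_locally_Lipschitz[OF M R] by blast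
  have "\<exists>i\<in>{1..m}. (f i \<circ> R x) 0 \<le> (f i \<circ> R x) \<xi>" if "\<xi> \<in> ball 0 (min r (\<sigma> / C))" for \<xi>
  proof -
    have "rdist M x (R x \<xi>) \<le> ereal (C * norm \<xi>)"
      using RC[of 0 \<xi>] that r by (simp add: R0)
    also have "\<dots> < ereal \<sigma>" using that r by (simp add: field_simps)
    finally have "\<not> (\<forall>i\<in>{1..m}. f i (R x \<xi>) < f i x)"
      using no by (auto simp: riemannian_ball_def)
    then show ?thesis by (auto simp: R0 not_less)
  qed
  moreover have "eventually (\<lambda>\<xi>. \<xi> \<in> ball 0 (min r (\<sigma> / C))) (nhds (0::'e))"
    using r \<sigma> by (intro eventually_nhds_in_open) auto
  ultimately show ?thesis by (auto elim!: eventually_mono)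
qed

theorem theorem3p2:
  fixes M :: "('m::{t2_space, second_countable_topology}, 'e::euclidean_space) riemannian"
    and R :: "'m \<Rightarrow> 'e \<Rightarrow> 'm"
    and m :: nat
    and f :: "nat \<Rightarrow> 'm \<Rightarrow> real"
    and x :: 'm
  assumes "riemannian_manifold M"
    and "riemannian_complete M"
    and "riemannian_retraction M R"
    and "\<exists>\<kappa>>0. \<forall>y \<xi>. rdist M (R y \<xi>) y \<le> ereal (\<kappa> * tangent_norm M y \<xi>)"
    and "\<forall>i\<in>{1..m}. riemannian_locally_Lipschitz M (f i)"
    and "local_weak_Pareto M m f x"
  shows "0 \<in> convex hull (\<Union>i\<in>{1..m}. riemannian_subdifferential M R (f i) x)"
proof -
  note M = \<open>riemannian_manifold M\<close> and R = \<open>riemannian_retraction M R\<close>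
  have "0 \<in> convex hull (\<Union>i\<in>{1..m}. clarke_subdifferential (metric M x) (f i \<circ> R x) 0)"
  proof (rule zero_in_hull_of_clarke_subdifferentials)
    show "inner_product (metric M x)" using M by (simp add: riemannian_manifold_def)
    show "\<exists>r>0. \<exists>L. L-lipschitz_on (ball 0 r) (f i \<circ> R x)" if "i \<in> {1..m}" for i
      using that assms(5) by (intro pullback_locally_Lipschitz[OF M R]) blast
    show "eventually (\<lambda>\<xi>. \<exists>i\<in>{1..m}. (f i \<circ> R x) 0 \<le> (f i \<circ> R x) \<xi>) (nhds 0)"
      using assms(6) by (rule Pareto_pullback[OF M R])
  qed simp
  then show ?thesis by (simp add: riemannian_subdifferential_def)
qed

end
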